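(* For any integer $k\geq 1$, $$F(z)=(\tau_{\alpha,0}\circ\tau_{\alpha,1}\circ\cdots\circ\tau_{\alpha,k-1})(F_{k}(z)).$$ As a result, $F(z)$ has the formal matrix continued fraction expansion (understood as the compositions of the transformations $\tau_{\alpha,k}$ in the identities $F(z)=(\tau_{\alpha,0}\circ\tau_{\alpha,1}\circ\cdots\circ\tau_{\alpha,k-1})(F_{k}(z))$, $k\geq 1$) $$F(z)=\cfrac{{\bf 1}}{\alpha_{0}(z)+\alpha^{+}_0\cfrac{{\bf 1}}{\alpha_{1}(z)+\alpha^{+}_1\cfrac{{\bf 1}}{\alpha_{2}(z)+\alpha^{+}_2\cfrac{{\bf 1}}{\alpha_{3}(z)+\ddots}\,\alpha^{-}_2}\,\alpha^{-}_1}\,\alpha^{-}_0}.$$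
   Context: Fix integers $p,q\geq 1$ and, for each $-p\leq k\leq q$, a bi-infinite sequence $(a^{(k)}_{n})_{n\in\mathbb{Z}}$ of complex numbers. Pseudo-quotient. For a $q\times p$ matrix $A=(a_{i,j})_{0\leq i\leq q-1,\,0\leq j\leq p-1}$ over a field with $a_{0,0}\neq 0$, let $T(A)=B=(b_{i,j})$ be the $q\times p$ matrix with $$b_{i,j}=\frac{a_{i+1,j+1}a_{0,0}-a_{0,j+1}a_{i+1,0}}{a_{0,0}}\ (0\leq i\leq q-2,\ 0\leq j\leq p-2),\quad b_{q-1,j}=-\frac{a_{0,j+1}}{a_{0,0}}\ (0\leq j\leq p-2),$$ $$b_{i,p-1}=\frac{a_{i+1,0}}{a_{0,0}}\ (0\leq i\leq q-2),\qquad b_{q-1,p-1}=\frac{1}{a_{0,0}}.$$ $T$ is a bijection from matrices with $a_{0,0}\neq 0$ onto matrices with $b_{q-1,p-1}\neq 0$; write $A=\frac{\mathbf 1}{B}$ if $B=T(A)$. Here the field is $\mathbb{C}((z^{-1}))$, the field of formal series $\sum_{n\in\mathbb{Z}}a_nz^n$ with complex coefficients and only finitely many nonzero $a_n$ with $n>0$. Coefficients. For $k\geq 0$: $\alpha_k^+$ is the $q\times q$ matrix equal to the identity except that its last row is $(-a_k^{(1)},-a_k^{(2)},\ldots,-a_k^{(q)})$; $\alpha_k^-$ is the $p\times p$ matrix equal to the identity except that its last column is $(a_k^{(-1)},a_k^{(-2)},\ldots,a_k^{(-p)})^{t}$; $\alpha_k(z)$ is the $q\times p$ matrix whose only nonzero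 entry is $z-a_k^{(0)}$ in the bottom right corner. For $q\times p$ matrices $X$, $$\tau_{\alpha,k}(X)=\frac{\mathbf 1}{\alpha_k(z)+\alpha_k^+X\alpha_k^-}.$$ Resolvent matrices. For $k\geq 0$ let $H^{[k]}=(h^{[k]}_{i,j})_{i,j\geq 0}$ be the banded matrix with $h^{[k]}_{i,j}=a^{(j-i)}_{k+\min(i,j)}$ if $-p\leq j-i\leq q$ and $0$ otherwise; so $H=H^{[0]}$ and $H^{[k]}$ is $H$ with its first $k$ rows and columns removed. Put $\phi^{(k)}_{i,j}(z)=\sum_{n=0}^{\infty}((H^{[k]})^n)_{i,j}\,z^{-n-1}$, and $\phi_{i,j}=\phi^{(0)}_{i,j}$. Define the $q\times p$ matrices $$F(z)=(\phi_{i,j}(z))_{0\leq i\leq q-1,\,0\leq j\leq p-1},\qquad F_k(z)=(\phi^{(k)}_{i,j}(z))_{0\leq i\leq q-1,\,0\leq j\leq p-1}\ (k\geq 1).$$ Equivalently, $\phi_{i,j}(z)=A_{i,j}(z)=\sum_{n\geq 0}A_{[n,i,j]}z^{-n-1}$, where $A_{[n,i,j]}$ is the sum of the weights of all lattice paths of $n$ steps from $(0,i)$ to $(n,j)$ with no point below the $x$-axis; steps go from $(n,m)$ to $(n+1,m+i)$, $0\leq i\leq q$, with weight $a_m^{(i)}$, or from $(n,m)$ to $(n+1,m-j)$, $1\leq j\leq p$, with weight $a_{m-j}^{(-j)}$; the weight of a path is the product of the weights of its steps ($1$ for the path of length zero), and an empty sum is zero. *)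

theory Defs
  imports
    "Jordan_Normal_Form.Matrix"
    "HOL-Computational_Algebra.Formal_Laurent_Series"
    "HOL-Library.Groups_Big_Fun"
begin

text \<open>
  The field \<open>\<complex>((z\<^sup>-\<^sup>1))\<close> is rendered as \<^typ>\<open>complex fls\<close> with the formal variable
  \<^const>\<open>fls_X\<close> playing the role of \<open>z\<^sup>-\<^sup>1\<close>; so \<open>z\<close> is \<^const>\<open>fls_X_inv\<close>, and the coefficient
  of \<open>z\<^sup>-\<^sup>n\<close> in \<open>f\<close> is \<open>fls_nth f n\<close>.

  The sequences \<open>(a\<^sup>(\<^sup>s\<^sup>)\<^sub>n)\<close> are a function \<open>a\<close> with \<open>a s n\<close> for superscript \<open>s\<close> and
  subscript \<open>n\<close>; values at superscripts outside \<open>{-p..q}\<close> are never used.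
\<close>

abbreviation zvar :: "complex fls" where
  "zvar \<equiv> fls_X_inv"

definition pseudo_quotient :: "'a::field mat \<Rightarrow> 'a mat" where
  "pseudo_quotient A = (let q = dim_row A; p = dim_col A in
     mat q p (\<lambda>(i, j).
       if i = q - 1 \<and> j = p - 1 then 1 / A $$ (0, 0)
       else if i = q - 1 then - (A $$ (0, j + 1) / A $$ (0, 0))
       else if j = p - 1 then A $$ (i + 1, 0) / A $$ (0, 0)
       else (A $$ (i + 1, j + 1) * A $$ (0, 0) - A $$ (0, j + 1) * A $$ (i + 1, 0)) / A $$ (0, 0)))"

definition pq_dom :: "nat \<Rightarrow> nat \<Rightarrow> 'a::field mat set" where
  "pq_dom q p = {A \<in> carrier_mat q p. A $$ (0, 0) \<noteq> 0}"

lemma pseudo_quotient_bij: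
  assumes "q \<ge> 1" "p \<ge> 1"
  shows "bij_betw (pseudo_quotient :: 'a::field mat \<Rightarrow> 'a mat)
           (pq_dom q p) {B \<in> carrier_mat q p. B $$ (q - 1, p - 1) \<noteq> 0}"
proof -
  define S where "S = (\<lambda>B :: 'a mat. mat q p (\<lambda>(i, j). let b = B $$ (q - 1, p - 1) in
     if i = 0 \<and> j = 0 then 1 / b
     else if i = 0 then - (B $$ (q - 1, j - 1) / b)
     else if j = 0 then B $$ (i - 1, p - 1) / b
     else B $$ (i - 1, j - 1) - B $$ (q - 1, j - 1) * B $$ (i - 1, p - 1) / b))"
  show ?thesis
  proof (rule bij_betw_byWitness[where f' = S])
    show "\<forall>A\<in>pq_dom q p. S (pseudo_quotient A) = A"
      using assms
      by (auto intro!: eq_matI simp: pq_dom_def S_def pseudo_quotient_def Let_def field_simps)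
    show "\<forall>B\<in>{B \<in> carrier_mat q p. B $$ (q - 1, p - 1) \<noteq> 0}. pseudo_quotient (S B) = B"
      using assms
      by (auto intro!: eq_matI simp: S_def pseudo_quotient_def Let_def field_simps)
    show "pseudo_quotient ` pq_dom q p \<subseteq> {B \<in> carrier_mat q p. B $$ (q - 1, p - 1) \<noteq> (0::'a)}"
      using assms by (auto simp: pq_dom_def pseudo_quotient_def Let_def)
    show "S ` {B \<in> carrier_mat q p. B $$ (q - 1, p - 1) \<noteq> 0} \<subseteq> pq_dom q p"
      using assms by (auto simp: pq_dom_def S_def Let_def)
  qed
qed

text \<open>
  The pseudo-quotient \<open>A = \<one>/B\<close> is a partial operation, defined when \<open>B = T(A)\<close> for
  some \<open>A\<close> with nonzero top left entry.  Compositions of the maps \<open>\<tau>\<close> are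
  therefore compositions of partial maps, and \<open>f X = Some Y\<close> includes the claim that every
  intermediate quotient is defined.
\<close>

definition one_over :: "nat \<Rightarrow> nat \<Rightarrow> 'a::field mat \<rightharpoonup> 'a mat" where
  "one_over q p B =
     (if B \<in> pseudo_quotient ` pq_dom q p
      then Some (the_inv_into (pq_dom q p) pseudo_quotient B) else None)"

lemma one_over_eq_Some_iff:
  assumes "q \<ge> 1" "p \<ge> 1"
  shows "one_over q p B = Some A \<longleftrightarrow>
           A \<in> carrier_mat q p \<and> A $$ (0, 0) \<noteq> 0 \<and> B = pseudo_quotient A"
proof -
  have inj: "inj_on pseudo_quotient (pq_dom q p :: 'a mat set)"
    using pseudo_quotient_bij[OF assms] by (rule bij_betw_imp_inj_on)
  show ?thesis
    using the_inv_into_f_f[OF inj] by (auto simp: one_over_def pq_dom_def)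
qed

lemma one_over_eq_None_iff:
  assumes "q \<ge> 1" "p \<ge> 1" "B \<in> carrier_mat q p"
  shows "one_over q p B = None \<longleftrightarrow> B $$ (q - 1, p - 1) = 0"
  using bij_betw_imp_surj_on[OF pseudo_quotient_bij[OF assms(1,2)]] assms(3)
  by (auto simp: one_over_def)

definition alpha_plus :: "nat \<Rightarrow> (int \<Rightarrow> int \<Rightarrow> complex) \<Rightarrow> nat \<Rightarrow> complex fls mat" where
  "alpha_plus q a k = mat q q (\<lambda>(i, j).
     if i = q - 1 then - fls_const (a (int j + 1) (int k)) else if i = j then 1 else 0)"

definition alpha_minus :: "nat \<Rightarrow> (int \<Rightarrow> int \<Rightarrow> complex) \<Rightarrow> nat \<Rightarrow> complex fls mat" where
  "alpha_minus p a k = mat p p (\<lambda>(i, j).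
     if j = p - 1 then fls_const (a (- (int i + 1)) (int k)) else if i = j then 1 else 0)"

definition alpha_z :: "nat \<Rightarrow> nat \<Rightarrow> (int \<Rightarrow> int \<Rightarrow> complex) \<Rightarrow> nat \<Rightarrow> complex fls mat" where
  "alpha_z q p a k = mat q p (\<lambda>(i, j).
     if i = q - 1 \<and> j = p - 1 then zvar - fls_const (a 0 (int k)) else 0)"

definition tau :: "nat \<Rightarrow> nat \<Rightarrow> (int \<Rightarrow> int \<Rightarrow> complex) \<Rightarrow> nat \<Rightarrow> complex fls mat \<rightharpoonup> complex fls mat" where
  "tau q p a k X = one_over q p (alpha_z q p a k + alpha_plus q a k * X * alpha_minus p a k)"

text \<open>\<open>comp_upto t k\<close> is \<open>t 0 \<circ>\<^sub>m t 1 \<circ>\<^sub>m \<dots> \<circ>\<^sub>m t (k - 1)\<close>.\<close>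

primrec comp_upto :: "(nat \<Rightarrow> 'b \<rightharpoonup> 'b) \<Rightarrow> nat \<Rightarrow> 'b \<rightharpoonup> 'b" where
  "comp_upto t 0 = Some"
| "comp_upto t (Suc k) = comp_upto t k \<circ>\<^sub>m t k"

definition banded_H :: "nat \<Rightarrow> nat \<Rightarrow> (int \<Rightarrow> int \<Rightarrow> complex) \<Rightarrow> nat \<Rightarrow> nat \<Rightarrow> nat \<Rightarrow> complex" where
  "banded_H q p a k i j =
     (if - int p \<le> int j - int i \<and> int j - int i \<le> int q
      then a (int j - int i) (int (k + min i j)) else 0)"

text \<open>
  Powers of infinite matrices.  \<^const>\<open>Sum_any\<close> sums over the support of the summand; for
  powers of a banded matrix this support is finite.
\<close>

primrec inf_mat_pow :: "(nat \<Rightarrow> nat \<Rightarrow> 'a::semiring_1) \<Rightarrow> nat \<Rightarrow> nat \<Rightarrow> nat \<Rightarrow> 'a" where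
  "inf_mat_pow M 0 = (\<lambda>i j. if i = j then 1 else 0)"
| "inf_mat_pow M (Suc n) = (\<lambda>i j. Sum_any (\<lambda>l. M i l * inf_mat_pow M n l j))"

lemma inf_mat_pow_banded_H_Suc:
  "inf_mat_pow (banded_H q p a k) (Suc n) i j =
     (\<Sum>l\<le>i + q. banded_H q p a k i l * inf_mat_pow (banded_H q p a k) n l j)"
  unfolding inf_mat_pow.simps
  by (rule Sum_any.expand_superset) (auto simp: banded_H_def split: if_splits)

definition phi :: "nat \<Rightarrow> nat \<Rightarrow> (int \<Rightarrow> int \<Rightarrow> complex) \<Rightarrow> nat \<Rightarrow> nat \<Rightarrow> nat \<Rightarrow> complex fls" where
  "phi q p a k i j =
     fls_X * fps_to_fls (Abs_fps (\<lambda>n. inf_mat_pow (banded_H q p a k) n i j))"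

lemma fls_nth_phi:
  "fls_nth (phi q p a k i j) m =
     (if m \<ge> 1 then inf_mat_pow (banded_H q p a k) (nat (m - 1)) i j else 0)"
  by (simp add: phi_def fls_X_times_conv_shift)

definition resolvent_mat :: "nat \<Rightarrow> nat \<Rightarrow> (int \<Rightarrow> int \<Rightarrow> complex) \<Rightarrow> nat \<Rightarrow> complex fls mat" where
  "resolvent_mat q p a k = mat q p (\<lambda>(i, j). phi q p a k i j)"

text \<open>
  The matrix continued fraction with transformations \<open>t 0, t 1, \<dots>\<close> is understood
  through its finite truncations: \<open>F\<close> is recovered from each remainder \<open>R k\<close> by
  applying the first \<open>k\<close> transformations.
\<close>

definition has_cf_expansion :: "'b \<Rightarrow> (nat \<Rightarrow> 'b \<rightharpoonup> 'b) \<Rightarrow> (nat \<Rightarrow> 'b) \<Rightarrow> bool" where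
  "has_cf_expansion F t R \<longleftrightarrow> (\<forall>k\<ge>1. comp_upto t k (R k) = Some F)"

end

theory Submission
  imports Defs
begin

text \<open>
  Formally \<open>\<phi>\<^sup>(\<^sup>k\<^sup>)\<close> is the resolvent \<open>(z - H\<^sup>[\<^sup>k\<^sup>])\<^sup>-\<^sup>1\<close>. Splitting off the first row \<open>(h, r)\<close> and the
  first column \<open>(h, c)\<close> of \<open>H\<^sup>[\<^sup>k\<^sup>]\<close> leaves \<open>H\<^sup>[\<^sup>k\<^sup>+\<^sup>1\<^sup>]\<close>, so block (Schur complement) inversion expresses
  the resolvent \<open>R\<close> of \<open>H\<^sup>[\<^sup>k\<^sup>]\<close> through the resolvent \<open>R'\<close> of \<open>H\<^sup>[\<^sup>k\<^sup>+\<^sup>1\<^sup>]\<close>: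
  \<open>1 / R\<^sub>0\<^sub>0 = z - h - r R' c\<close>, and the remaining blocks are \<open>R\<^sub>0\<^sub>0 r R'\<close>, \<open>R' c R\<^sub>0\<^sub>0\<close> and
  \<open>R' + R' c R\<^sub>0\<^sub>0 r R'\<close>. The pseudo-quotient undoes exactly these formulas.
  Infinite matrices are avoided: a column of the resolvent is the only solution of
  \<open>z x = e + H x\<close> whose entries are bounded in degree.
\<close>

text \<open>The bound is 0 rather than 1 because the zero series has subdegree 0.\<close>

lemma phi_subdegree_ge_0: "fls_subdegree (phi q p a k i j) \<ge> 0"
  by (intro fls_subdegree_ge0I) (simp add: fls_nth_phi)

text \<open>The resolvent equation \<open>z R = 1 + H R\<close>, which is the recursion for the
  powers of \<open>H\<close> read coefficientwise. Row \<open>i\<close> of \<open>H\<close> vanishes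
  beyond column \<open>i + q\<close>, so the sum is finite.\<close>

lemma zvar_times_phi:
  "zvar * phi q p a k i j =
     (if i = j then 1 else 0) +
     (\<Sum>l\<le>i + q. fls_const (banded_H q p a k i l) * phi q p a k l j)"
proof (rule fls_eqI)
  fix m :: int
  consider "m < 0" | "m = 0" | n where "m = int (Suc n)"
    by (metis int_cases not0_implies_Suc of_nat_0 negative_zless)
  then show "fls_nth (zvar * phi q p a k i j) m =
    fls_nth ((if i = j then 1 else 0) +
      (\<Sum>l\<le>i + q. fls_const (banded_H q p a k i l) * phi q p a k l j)) m"
  proof cases
    case 3
    then have "nat (m + 1 - 1) = Suc n" "nat (m - 1) = n" "m \<ge> 1"
      by simp_all
    then show ?thesis
      by (simp add: fls_X_inv_times_conv_shift fls_nth_sum fls_nth_phi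
          inf_mat_pow_banded_H_Suc del: inf_mat_pow.simps(2))
  qed (auto simp: fls_X_inv_times_conv_shift fls_nth_sum fls_nth_phi)
qed

text \<open>Multiplication by \<open>zvar\<close> shifts coefficients by one, so the equation
  computes those of index \<open>m + 1\<close> from those of index \<open>m\<close>. The subdegree
  bounds start this recursion: all coefficients of negative index are 0.\<close>

lemma column_unique:
  fixes x y b :: "nat \<Rightarrow> complex fls" and M :: "nat \<Rightarrow> nat \<Rightarrow> complex" and N :: "nat \<Rightarrow> nat"
  assumes x: "\<And>i. zvar * x i = b i + (\<Sum>l\<le>N i. fls_const (M i l) * x l)"
    and y: "\<And>i. zvar * y i = b i + (\<Sum>l\<le>N i. fls_const (M i l) * y l)"
    and "\<And>i. fls_subdegree (x i) \<ge> 0" "\<And>i. fls_subdegree (y i) \<ge> 0"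
  shows "x i = y i"
proof (rule fls_eqI)
  have step: "fls_nth (u i) (m + 1) = fls_nth (b i) m + (\<Sum>l\<le>N i. M i l * fls_nth (u l) m)"
    if "\<And>i. zvar * u i = b i + (\<Sum>l\<le>N i. fls_const (M i l) * u l)" for u i m
    using arg_cong[OF that[of i], of "\<lambda>f. fls_nth f m"]
    by (simp add: fls_X_inv_times_conv_shift fls_nth_sum)
  have neg: "fls_nth (x i) m = fls_nth (y i) m" if "m < 0" for i m
    using assms(3,4)[of i] that by simp
  \<comment> \<open>The induction starts at index -1, where both coefficients vanish.\<close>
  have nat: "fls_nth (x i) (int n - 1) = fls_nth (y i) (int n - 1)" for i n
  proof (induction n arbitrary: i)
    case (Suc n)
    then show ?case
      using step[OF x, of i "int n - 1"] step[OF y, of i "int n - 1"] by simp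
  qed (simp add: neg)
  show "fls_nth (x i) m = fls_nth (y i) m" for m
    using neg nat[of i "nat (m + 1)"] by (cases "m < 0") auto
qed

lemma fls_subdegree_sum_ge_0:
  assumes "\<And>i. i \<in> A \<Longrightarrow> fls_subdegree (f i) \<ge> 0"
  shows "fls_subdegree (\<Sum>i\<in>A. f i) \<ge> 0"
  by (intro fls_subdegree_ge0I)
    (auto simp: fls_nth_sum intro!: sum.neutral fls_eq0_below_subdegree dest: assms)

lemma banded_H_Suc_Suc: "banded_H q p a k (Suc i) (Suc j) = banded_H q p a (Suc k) i j"
  by (simp add: banded_H_def)

text \<open>The vectors \<open>R' c\<close> and \<open>r R'\<close> of the block inversion.\<close>

definition phi_col :: "nat \<Rightarrow> nat \<Rightarrow> (int \<Rightarrow> int \<Rightarrow> complex) \<Rightarrow> nat \<Rightarrow> nat \<Rightarrow> complex fls" where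
  "phi_col q p a k i =
     (\<Sum>t<p. phi q p a (Suc k) i t * fls_const (banded_H q p a k (Suc t) 0))"

definition row_phi :: "nat \<Rightarrow> nat \<Rightarrow> (int \<Rightarrow> int \<Rightarrow> complex) \<Rightarrow> nat \<Rightarrow> nat \<Rightarrow> complex fls" where
  "row_phi q p a k j =
     (\<Sum>s<q. fls_const (banded_H q p a k 0 (Suc s)) * phi q p a (Suc k) s j)"

lemma phi_col_subdegree_ge_0: "fls_subdegree (phi_col q p a k i) \<ge> 0"
  unfolding phi_col_def
  by (intro fls_subdegree_sum_ge_0 fls_mult_subdegree_ge_0 phi_subdegree_ge_0) simp

text \<open>This is the resolvent equation for \<open>R'\<close> multiplied by \<open>c\<close> from
  the right.\<close>

lemma zvar_times_phi_col:
  "zvar * phi_col q p a k i =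
     fls_const (banded_H q p a k (Suc i) 0) +
     (\<Sum>l\<le>i + q. fls_const (banded_H q p a (Suc k) i l) * phi_col q p a k l)"
proof -
  let ?c = "\<lambda>t. fls_const (banded_H q p a k (Suc t) 0)"
  have "zvar * phi_col q p a k i = (\<Sum>t<p. (zvar * phi q p a (Suc k) i t) * ?c t)"
    by (simp add: phi_col_def sum_distrib_left mult.assoc)
  also have "\<dots> = (\<Sum>t<p. (if i = t then ?c t else 0)) +
      (\<Sum>t<p. \<Sum>l\<le>i + q. fls_const (banded_H q p a (Suc k) i l) * (phi q p a (Suc k) l t * ?c t))"
    by (simp add: zvar_times_phi distrib_right sum.distrib sum_distrib_right mult.assoc
        if_distrib[of "\<lambda>u. u * _"] cong: if_cong)
  \<comment> \<open>For \<open>i \<ge> p\<close> the left side is 0, and so is \<open>?c i\<close>,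
    since it lies outside the band.\<close>
  also have "(\<Sum>t<p. (if i = t then ?c t else 0)) = ?c i"
    by (simp add: banded_H_def)
  also have "(\<Sum>t<p. \<Sum>l\<le>i + q. fls_const (banded_H q p a (Suc k) i l) * (phi q p a (Suc k) l t * ?c t))
      = (\<Sum>l\<le>i + q. fls_const (banded_H q p a (Suc k) i l) * phi_col q p a k l)"
    by (subst sum.swap) (simp add: phi_col_def sum_distrib_left)
  finally show ?thesis .
qed

text \<open>In the resolvent equation without its row 0, the top entry
  \<open>phi q p a k 0 j\<close> counts as known. What remains is a system with matrix
  \<open>H\<close> at level \<open>Suc k\<close>, and both sides solve it.\<close>

lemma phi_Suc_left:
  "phi q p a k (Suc i) j =
     (case j of 0 \<Rightarrow> 0 | Suc j' \<Rightarrow> phi q p a (Suc k) i j') +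
     phi_col q p a k i * phi q p a k 0 j"
proof -
  \<comment> \<open>The inhomogeneous term: the identity entry plus the first column of
    \<open>H\<close> times the top entry.\<close>
  define b :: "nat \<Rightarrow> complex fls" where
    "b = (\<lambda>i. (if Suc i = j then 1 else 0) +
       fls_const (banded_H q p a k (Suc i) 0) * phi q p a k 0 j)"
  define y where "y = (\<lambda>i. (case j of 0 \<Rightarrow> 0 | Suc j' \<Rightarrow> phi q p a (Suc k) i j') +
     phi_col q p a k i * phi q p a k 0 j)"
  have "phi q p a k (Suc i) j = y i"
  proof (rule column_unique[where b = b and N = "\<lambda>i. i + q" and M = "banded_H q p a (Suc k)"
          and x = "\<lambda>i. phi q p a k (Suc i) j"])
    show "zvar * phi q p a k (Suc i) j =
        b i + (\<Sum>l\<le>i + q. fls_const (banded_H q p a (Suc k) i l) * phi q p a k (Suc l) j)" for i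
      by (simp add: zvar_times_phi b_def sum.atMost_Suc_shift banded_H_Suc_Suc
          del: sum.atMost_Suc)
    show "zvar * y i = b i + (\<Sum>l\<le>i + q. fls_const (banded_H q p a (Suc k) i l) * y l)" for i
      using zvar_times_phi_col[of q p a k i]
      by (cases j) (simp_all add: y_def b_def zvar_times_phi distrib_left distrib_right sum.distrib
          sum_distrib_right mult.assoc flip: mult.assoc[of zvar "phi_col q p a k i"])
    show "fls_subdegree (y i) \<ge> 0" for i
      using phi_subdegree_ge_0[of q p a "Suc k" i]
        fls_mult_subdegree_ge_0[OF phi_col_subdegree_ge_0[of q p a k i] phi_subdegree_ge_0[of q p a k 0 j]]
      by (intro fls_subdegree_ge0I)
        (auto simp: y_def intro!: fls_eq0_below_subdegree elim: order.strict_trans2 split: nat.split)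
  qed (rule phi_subdegree_ge_0)
  then show ?thesis
    by (simp add: y_def)
qed

definition schur :: "nat \<Rightarrow> nat \<Rightarrow> (int \<Rightarrow> int \<Rightarrow> complex) \<Rightarrow> nat \<Rightarrow> complex fls" where
  "schur q p a k = zvar - fls_const (banded_H q p a k 0 0) -
     (\<Sum>s<q. fls_const (banded_H q p a k 0 (Suc s)) * phi_col q p a k s)"

text \<open>Row 0 of the resolvent equation, with the lower entries of the column eliminated by
  \<open>phi_Suc_left\<close>.\<close>

lemma schur_times_phi_0:
  "schur q p a k * phi q p a k 0 j = (case j of 0 \<Rightarrow> 1 | Suc j' \<Rightarrow> row_phi q p a k j')"
proof -
  have "zvar * phi q p a k 0 j = (if 0 = j then 1 else 0) +
      (fls_const (banded_H q p a k 0 0) * phi q p a k 0 j +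
       (\<Sum>s<q. fls_const (banded_H q p a k 0 (Suc s)) * phi q p a k (Suc s) j))"
    by (simp add: zvar_times_phi sum.atMost_shift)
  then show ?thesis
    by (cases j) (simp_all add: phi_Suc_left schur_def row_phi_def algebra_simps sum.distrib
        sum_distrib_left sum_distrib_right)
qed

lemma schur_nonzero: "schur q p a k \<noteq> 0"
  using schur_times_phi_0[of q p a k 0] by auto

lemma phi_0_0: "phi q p a k 0 0 = 1 / schur q p a k"
  using schur_times_phi_0[of q p a k 0] schur_nonzero[of q p a k] by (simp add: field_simps)

lemma phi_0_Suc: "phi q p a k 0 (Suc j) = row_phi q p a k j / schur q p a k"
  using schur_times_phi_0[of q p a k "Suc j"] schur_nonzero[of q p a k] by (simp add: field_simps)

text \<open>Both sides are compared entrywise: the corner is \<open>schur\<close>, the rest of the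
  last row is \<open>- r R'\<close>, the rest of the last column is \<open>R' c\<close>, and all
  other entries are those of \<open>R'\<close>.\<close>

lemma pseudo_quotient_resolvent_mat:
  "pseudo_quotient (resolvent_mat q p a k) =
    alpha_z q p a k + alpha_plus q a k * resolvent_mat q p a (Suc k) * alpha_minus p a k"
    (is "?L = ?R")
proof (rule eq_matI)
  let ?P = "\<lambda>i j. phi q p a (Suc k) i j"
  have row: "fls_const (banded_H q p a k 0 (Suc s)) = fls_const (a (int s + 1) (int k))"
    if "s < q" for s
    using that by (simp add: banded_H_def add.commute)
  have col: "fls_const (banded_H q p a k (Suc t) 0) = fls_const (a (- (int t + 1)) (int k))"
    if "t < p" for t
  proof -
    have "banded_H q p a k (Suc t) 0 = a (int 0 - int (Suc t)) (int k)"
      using that by (simp add: banded_H_def)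
    also have "int 0 - int (Suc t) = - (int t + 1)"
      by simp
    finally show ?thesis
      by (simp only:)
  qed
  have plus: "(alpha_plus q a k * resolvent_mat q p a (Suc k)) $$ (i, t) =
      (if i = q - 1 then - row_phi q p a k t else ?P i t)" if "i < q" "t < p" for i t
  proof -
    have "(alpha_plus q a k * resolvent_mat q p a (Suc k)) $$ (i, t) =
      (\<Sum>s = 0..<q. (if i = q - 1 then - fls_const (a (int s + 1) (int k))
         else if i = s then 1 else 0) * ?P s t)"
      using that by (simp add: alpha_plus_def resolvent_mat_def scalar_prod_def)
    also have "\<dots> = (if i = q - 1 then - row_phi q p a k t else ?P i t)"
      using that by (auto simp: row_phi_def row sum_negf atLeast0LessThan
          if_distrib[of "\<lambda>u. u * _"] cong: if_cong)
    finally show ?thesis .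
  qed
  have minus: "(X * alpha_minus p a k) $$ (i, j) =
      (if j = p - 1 then \<Sum>t<p. X $$ (i, t) * fls_const (banded_H q p a k (Suc t) 0)
       else X $$ (i, j))" if "i < q" "j < p" "X \<in> carrier_mat q p" for X i j
  proof -
    have "(X * alpha_minus p a k) $$ (i, j) =
      (\<Sum>t = 0..<p. X $$ (i, t) * (if j = p - 1 then fls_const (a (- (int t + 1)) (int k))
         else if t = j then 1 else 0))"
      using that by (auto simp add: alpha_minus_def scalar_prod_def)
    also have "\<dots> = (if j = p - 1 then \<Sum>t<p. X $$ (i, t) * fls_const (banded_H q p a k (Suc t) 0)
       else X $$ (i, j))"
      using that by (auto simp: col atLeast0LessThan if_distrib[of "\<lambda>u. _ * u"] cong: if_cong)
    finally show ?thesis .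
  qed
  \<comment> \<open>Associativity \<open>(r R') c = r (R' c)\<close> turns the corner entry into the
    form used in \<open>schur\<close>.\<close>
  have row_col: "(\<Sum>t<p. row_phi q p a k t * fls_const (banded_H q p a k (Suc t) 0)) =
      (\<Sum>s<q. fls_const (banded_H q p a k 0 (Suc s)) * phi_col q p a k s)"
    unfolding row_phi_def phi_col_def sum_distrib_left sum_distrib_right
    by (subst sum.swap) (simp add: mult.assoc)
  fix i j
  assume "i < dim_row ?R" "j < dim_col ?R"
  then have ij: "i < q" "j < p"
    by (simp_all add: alpha_plus_def alpha_minus_def)
  let ?X = "alpha_plus q a k * resolvent_mat q p a (Suc k)"
  have X: "?X \<in> carrier_mat q p"
    by (rule mult_carrier_mat[of _ q q]) (simp_all add: alpha_plus_def resolvent_mat_def)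
  have "?R $$ (i, j) = alpha_z q p a k $$ (i, j) + (?X * alpha_minus p a k) $$ (i, j)"
    using ij by (subst index_add_mat(1)) (simp_all add: alpha_plus_def alpha_minus_def)
  also have "\<dots> = alpha_z q p a k $$ (i, j) +
      (if j = p - 1 then
         if i = q - 1 then - (\<Sum>t<p. row_phi q p a k t * fls_const (banded_H q p a k (Suc t) 0))
         else phi_col q p a k i
       else if i = q - 1 then - row_phi q p a k j else ?P i j)"
    unfolding minus[OF ij X] plus[OF ij] using plus[OF ij(1)]
    by (simp add: sum_negf phi_col_def)
  also have "\<dots> =
      (if i = q - 1 \<and> j = p - 1 then schur q p a k
       else if i = q - 1 then - row_phi q p a k j
       else if j = p - 1 then phi_col q p a k i
       else ?P i j)"
    unfolding row_col using ij by (simp add: alpha_z_def schur_def banded_H_def)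
  also have "\<dots> = ?L $$ (i, j)"
  proof -
    have "?L $$ (i, j) =
       (if i = q - 1 \<and> j = p - 1 then 1 / phi q p a k 0 0
        else if i = q - 1 then - (phi q p a k 0 (Suc j) / phi q p a k 0 0)
        else if j = p - 1 then phi q p a k (Suc i) 0 / phi q p a k 0 0
        else (phi q p a k (Suc i) (Suc j) * phi q p a k 0 0 -
          phi q p a k 0 (Suc j) * phi q p a k (Suc i) 0) / phi q p a k 0 0)"
      using ij by (simp add: pseudo_quotient_def Let_def resolvent_mat_def)
    \<comment> \<open>The subtracted product cancels the rank-one correction
      \<open>R' c R\<^sub>0\<^sub>0 r R'\<close> of the lower right block.\<close>
    also have "(phi q p a k (Suc i) (Suc j) * phi q p a k 0 0 -
        phi q p a k 0 (Suc j) * phi q p a k (Suc i) 0) / phi q p a k 0 0 = ?P i j"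
      using schur_nonzero[of q p a k] by (simp add: phi_Suc_left phi_0_0 algebra_simps)
    also have "phi q p a k (Suc i) 0 / phi q p a k 0 0 = phi_col q p a k i"
      using schur_nonzero[of q p a k] by (simp add: phi_Suc_left phi_0_0)
    also have "phi q p a k 0 (Suc j) / phi q p a k 0 0 = row_phi q p a k j"
      using schur_nonzero[of q p a k] by (simp add: phi_0_Suc phi_0_0)
    finally show ?thesis
      by (simp add: phi_0_0)
  qed
  finally show "?L $$ (i, j) = ?R $$ (i, j)"
    by simp
qed (simp_all add: pseudo_quotient_def Let_def alpha_plus_def alpha_minus_def resolvent_mat_def)

text \<open>The quotient is defined because the top left entry \<open>1 / schur q p a k\<close> is
  nonzero.\<close>

lemma tau_resolvent_mat:
  assumes "p \<ge> 1" and "q \<ge> 1"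
  shows "tau q p a k (resolvent_mat q p a (Suc k)) = Some (resolvent_mat q p a k)"
  using assms schur_nonzero[of q p a k]
  by (simp add: tau_def one_over_eq_Some_iff pseudo_quotient_resolvent_mat)
    (simp add: resolvent_mat_def phi_0_0)

theorem theorem6p2:
  fixes p q :: nat and a :: "int \<Rightarrow> int \<Rightarrow> complex"
  assumes "p \<ge> 1" and "q \<ge> 1"
  shows "(\<forall>k\<ge>1. comp_upto (tau q p a) k (resolvent_mat q p a k) = Some (resolvent_mat q p a 0))
    \<and> has_cf_expansion (resolvent_mat q p a 0) (tau q p a) (resolvent_mat q p a)"
proof -
  have "comp_upto (tau q p a) k (resolvent_mat q p a k) = Some (resolvent_mat q p a 0)" for k
    \<comment> \<open>The map with the largest index is innermost and acts first, taking the
      remainder at \<open>Suc k\<close> to the one at \<open>k\<close>.\<close>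
    by (induction k) (simp_all add: map_comp_def tau_resolvent_mat[OF assms])
  then show ?thesis
    by (simp add: has_cf_expansion_def)
qed

end
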